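(* Let $\alpha<0$, $\beta<0$ and $0<y_1\le y_2\le 1$ be arbitrary real numbers, and let $f(r)=\alpha r+\beta r^2$. Then there is an ellipsoid $E_0\subset\mathbb{R}^3$, centered at the origin with its axes on the coordinate axes, such that if $E(t)$, $t\ge0$, is the family of bodies evolving from $E(0)=E_0$ under the radial distance-driven flow $r_t=f(r)$, with axis ratios $0<y_1(t)\le y_2(t)\le 1$, then $\lim_{t\to\infty}y_i(t)=y_i$ for $i=1,2$.
   Context: Radial distance-driven flow: the boundary of $E(t)$ is $\{r(u,t)u:u\in\mathbb{S}^2\}$, where for each $u\in\mathbb{S}^2$ the function $t\mapsto r(u,t)$ solves $r_t(u,t)=f(r(u,t))$, and $r(\cdot,0)$ is the radial function of $E_0$ (distance of the boundary from the origin in direction $u$). The axis ratios of $E(t)$ are those of its approximating ellipsoid (the ellipsoid with axes on the coordinate axes passing through the boundary points of $E(t)$ on the coordinate axes): if $c(t)\le b(t)\le a(t)$ are the values of $r(\cdot,t)$ in the directions of the three coordinate axes, in increasing order, then $y_1(t)=c(t)/a(t)$ and $y_2(t)=b(t)/a(t)$. *)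

theory Defs
  imports "HOL-Analysis.Analysis"
begin

definition coordinate_ellipsoid :: "(real ^ 3) set \<Rightarrow> bool" where
  "coordinate_ellipsoid K \<longleftrightarrow>
     (\<exists>p :: real ^ 3. (\<forall>i. 0 < p $ i) \<and> K = {x. (\<Sum>i\<in>UNIV. (x $ i / p $ i)\<^sup>2) \<le> 1})"

text \<open>The distance from the origin of the boundary point of \<open>K\<close> in direction \<open>u\<close>;
  meaningful only if the ray through the unit vector \<open>u\<close> meets the boundary exactly once.\<close>

definition radial_function :: "(real ^ 3) set \<Rightarrow> real ^ 3 \<Rightarrow> real" where
  "radial_function K u = (THE s. 0 < s \<and> s *\<^sub>R u \<in> frontier K)"

text \<open>The condition on the frontier alone would also admit the bare surface as \<open>E t\<close>;
  together with compactness and \<open>0 \<in> interior (E t)\<close> it makes \<open>E t\<close> the solid body enclosed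
  by that surface. At \<open>t = 0\<close> the derivative is one-sided.\<close>

definition radial_flow ::
  "(real \<Rightarrow> real) \<Rightarrow> (real ^ 3) set \<Rightarrow> (real \<Rightarrow> (real ^ 3) set) \<Rightarrow> (real ^ 3 \<Rightarrow> real \<Rightarrow> real) \<Rightarrow> bool"
where
  "radial_flow f E0 E r \<longleftrightarrow>
     E 0 = E0 \<and>
     (\<forall>t\<ge>0. compact (E t) \<and> 0 \<in> interior (E t) \<and>
             frontier (E t) = {r u t *\<^sub>R u | u. u \<in> sphere 0 1}) \<and>
     (\<forall>u\<in>sphere 0 1.
        r u 0 = radial_function E0 u \<and>
        (\<forall>t\<ge>0. 0 < r u t \<and> (r u has_real_derivative f (r u t)) (at t within {0..})))"

text \<open>The values \<open>c \<le> b \<le> a\<close> of \<open>r(\<cdot>, t)\<close> in the directions of the coordinate axes,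
  as a sorted list. For origin-symmetric \<open>E t\<close> these are the semi-axes of the ellipsoid with axes
  on the coordinate axes through the boundary points of \<open>E t\<close> on those axes.\<close>

definition axis_values :: "(real ^ 3 \<Rightarrow> real \<Rightarrow> real) \<Rightarrow> real \<Rightarrow> real list" where
  "axis_values r t = sort (map (\<lambda>i :: 3. r (axis i 1) t) [1, 2, 3])"

definition axis_ratio1 :: "(real ^ 3 \<Rightarrow> real \<Rightarrow> real) \<Rightarrow> real \<Rightarrow> real" where
  "axis_ratio1 r t = axis_values r t ! 0 / axis_values r t ! 2"

definition axis_ratio2 :: "(real ^ 3 \<Rightarrow> real \<Rightarrow> real) \<Rightarrow> real \<Rightarrow> real" where
  "axis_ratio2 r t = axis_values r t ! 1 / axis_values r t ! 2"

end

theory Submission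
  imports Defs
begin

text \<open>
  The substitution \<open>w = 1 / r\<close> turns \<open>r' = \<alpha> r + \<beta> r\<^sup>2\<close> into the linear equation
  \<open>w' = - \<alpha> w - \<beta>\<close>. Hence, with \<open>k = \<beta> / \<alpha> > 0\<close>, every positive solution satisfies
  \<open>1 / r t = (1 / r 0 + k) exp (- \<alpha> t) - k\<close> (\<open>reciprocal_of_radial_solution\<close>). As \<open>\<alpha> < 0\<close>,
  the exponential dominates, and the quotient of two solutions tends to the inverse quotient of
  the numbers \<open>1 / r 0 + k\<close> (\<open>ratio_of_solutions_limit\<close>). An ellipsoid with longest semi-axis \<open>1\<close>
  therefore acquires the limit ratio \<open>y\<close> along an axis exactly if the reciprocal semi-axis \<open>q\<close>
  there satisfies \<open>(1 + k) / (q + k) = y\<close>. The solution \<open>q = (1 + k) / y - k\<close> is at least \<open>1\<close>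
  because \<open>y \<le> 1\<close>, and it decreases in \<open>y\<close>, so the axes come in the required order; the flow
  preserves this order because the explicit solution is monotone in the initial value.

  The evolution also has to exist as a family of bodies. If \<open>N\<close> is the norm whose unit ball is
  \<open>E\<^sub>0\<close>, then \<open>r u 0 = 1 / N u\<close>, and extending \<open>1 / r u t\<close> from unit vectors \<open>u\<close> to the whole
  space homogeneously gives
  \<open>G\<^sub>t x = exp (- \<alpha> t) N x + k (exp (- \<alpha> t) - 1) \<parallel>x\<parallel>\<close>. This is continuous and
  positive for \<open>x \<noteq> 0\<close>, so \<open>{x. G\<^sub>t x \<le> 1}\<close> is a solid body with radial function
  \<open>1 / G\<^sub>t\<close> (locale \<open>positive_gauge\<close>).
\<close>

section \<open>Bodies bounded by a positively homogeneous function\<close>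

locale positive_gauge =
  fixes G :: "'a :: euclidean_space \<Rightarrow> real"
  assumes continuous: "continuous_on UNIV G"
    and positive: "x \<noteq> 0 \<Longrightarrow> 0 < G x"
    and homogeneous: "0 \<le> c \<Longrightarrow> G (c *\<^sub>R x) = c * G x"
begin

lemma zero [simp]: "G 0 = 0"
  using homogeneous[of 0 0] by simp

text \<open>Boundedness comes from the minimum of \<open>G\<close> on the unit sphere, which is positive by
  compactness.\<close>

lemma compact_sublevel: "compact {x. G x \<le> 1}"
proof -
  have "\<exists>m\<in>sphere 0 1. \<forall>u\<in>sphere 0 1. G m \<le> G u"
    by (intro continuous_attains_inf continuous_on_subset[OF continuous]) simp_all
  then obtain m where m: "m \<in> sphere 0 1" "\<And>u. u \<in> sphere 0 1 \<Longrightarrow> G m \<le> G u"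
    by blast
  have pos: "0 < G m"
    using m(1) by (intro positive) auto
  have "norm x \<le> 1 / G m" if "G x \<le> 1" for x
  proof (cases "x = 0")
    case False
    have "G m \<le> G (x /\<^sub>R norm x)"
      using False by (intro m(2)) simp
    also have "\<dots> = G x / norm x"
      by (simp add: homogeneous divide_inverse mult.commute)
    finally have "G m * norm x \<le> G x"
      using False by (simp add: pos_le_divide_eq)
    then show ?thesis
      using pos that by (simp add: pos_le_divide_eq mult.commute)
  qed (use pos in simp)
  then have "bounded {x. G x \<le> 1}"
    by (auto simp: bounded_iff)
  moreover have "closed {x. G x \<le> 1}"
    by (intro closed_Collect_le continuous continuous_on_const)
  ultimately show ?thesis
    by (simp add: compact_eq_bounded_closed)
qed

lemma strict_sublevel_subset_interior: "{x. G x < 1} \<subseteq> interior {x. G x \<le> 1}"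
proof (rule interior_maximal)
  show "open {x. G x < 1}"
    by (intro open_Collect_less continuous continuous_on_const)
qed auto

lemma zero_in_interior_sublevel: "0 \<in> interior {x. G x \<le> 1}"
  using strict_sublevel_subset_interior by auto

text \<open>A point with \<open>G x = 1\<close> leaves the sublevel set under any stretching by a factor
  \<open>> 1\<close>, so it cannot be interior.\<close>

lemma frontier_sublevel: "frontier {x. G x \<le> 1} = {x. G x = 1}"
proof -
  have outside: "x \<notin> interior {x. G x \<le> 1}" if x: "G x = 1" for x
  proof
    assume "x \<in> interior {x. G x \<le> 1}"
    then obtain e where e: "0 < e" "ball x e \<subseteq> {x. G x \<le> 1}"
      by (auto simp: mem_interior)
    have "x \<noteq> 0"
      using x by auto
    define c where "c = 1 + e / (2 * norm x)"
    have c: "1 < c"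
      using e(1) \<open>x \<noteq> 0\<close> by (simp add: c_def)
    have "dist x (c *\<^sub>R x) = norm ((c - 1) *\<^sub>R x)"
      by (simp add: dist_norm norm_minus_commute[of x] scaleR_diff_left)
    also have "\<dots> = e / 2"
      using e(1) \<open>x \<noteq> 0\<close> by (simp add: c_def)
    finally have "c *\<^sub>R x \<in> ball x e"
      using e(1) by simp
    then have "G (c *\<^sub>R x) \<le> 1"
      using e(2) by blast
    then show False
      using c x by (simp add: homogeneous)
  qed
  have "frontier {x. G x \<le> 1} = {x. G x \<le> 1} - interior {x. G x \<le> 1}"
    by (simp add: frontier_def compact_imp_closed compact_sublevel)
  also have "\<dots> = {x. G x = 1}"
  proof (intro equalityI subsetI)
    fix x
    assume "x \<in> {x. G x \<le> 1} - interior {x. G x \<le> 1}"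
    then have "G x \<le> 1" "\<not> G x < 1"
      using strict_sublevel_subset_interior by blast+
    then show "x \<in> {x. G x = 1}"
      by simp
  next
    fix x
    assume "x \<in> {x. G x = 1}"
    then show "x \<in> {x. G x \<le> 1} - interior {x. G x \<le> 1}"
      using outside[of x] by simp
  qed
  finally show ?thesis .
qed

lemma frontier_sublevel_radial:
  "frontier {x. G x \<le> 1} = {(1 / G u) *\<^sub>R u | u. u \<in> sphere 0 1}"
proof -
  have "\<exists>u. x = (1 / G u) *\<^sub>R u \<and> u \<in> sphere 0 1" if "G x = 1" for x
  proof -
    have "x \<noteq> 0"
      using that by auto
    with that show ?thesis
      by (intro exI[of _ "x /\<^sub>R norm x"]) (simp add: homogeneous)
  qed
  moreover have "G ((1 / G u) *\<^sub>R u) = 1" if "u \<in> sphere 0 1" for u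
  proof -
    have "u \<noteq> 0"
      using that by auto
    with positive[OF this] show ?thesis
      by (simp add: homogeneous)
  qed
  ultimately show ?thesis
    unfolding frontier_sublevel by blast
qed

end

lemma radial_function_sublevel:
  assumes "positive_gauge G" and "u \<noteq> 0"
  shows "radial_function {x. G x \<le> 1} u = 1 / G u"
proof -
  interpret positive_gauge G by fact
  have "0 < G u"
    using assms(2) by (rule positive)
  then show ?thesis
    unfolding radial_function_def frontier_sublevel
    by (intro the_equality) (auto simp: homogeneous eq_divide_eq)
qed

section \<open>Solutions of the radial equation\<close>

text \<open>The reason is that \<open>(1 / r + k) exp (\<alpha> t)\<close> has derivative zero.\<close>

lemma reciprocal_of_radial_solution:
  fixes \<alpha> \<beta> :: real
  assumes "\<alpha> \<noteq> 0"
    and pos: "\<And>t. 0 \<le> t \<Longrightarrow> 0 < r t"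
    and ode: "\<And>t. 0 \<le> t \<Longrightarrow>
      (r has_real_derivative \<alpha> * r t + \<beta> * (r t)\<^sup>2) (at t within {0..})"
    and "0 \<le> t"
  shows "1 / r t = (1 / r 0 + \<beta> / \<alpha>) * exp (- \<alpha> * t) - \<beta> / \<alpha>"
proof -
  let ?h = "\<lambda>t. (1 / r t + \<beta> / \<alpha>) * exp (\<alpha> * t)"
  have "(?h has_real_derivative 0) (at s within {0..})" if "s \<in> {0..}" for s
    using that pos[of s] \<open>\<alpha> \<noteq> 0\<close>
    by (auto intro!: derivative_eq_intros ode simp: field_simps power2_eq_square)
  then obtain c where "\<And>s. s \<in> {0..} \<Longrightarrow> ?h s = c"
    using has_field_derivative_zero_constant[of "{0..}" ?h] by auto
  then have "?h t = ?h 0"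
    using \<open>0 \<le> t\<close> by (metis atLeast_iff order_refl)
  then have "?h t * exp (- \<alpha> * t) = (1 / r 0 + \<beta> / \<alpha>) * exp (- \<alpha> * t)"
    by simp
  then show ?thesis
    by (simp add: mult.assoc flip: exp_add)
qed

lemma radial_solution_of_reciprocal:
  fixes \<alpha> \<beta> :: real
  assumes "\<alpha> \<noteq> 0" and "g t \<noteq> 0"
    and g: "\<And>s. g s = (w + \<beta> / \<alpha>) * exp (- \<alpha> * s) - \<beta> / \<alpha>"
  shows "((\<lambda>s. 1 / g s) has_real_derivative \<alpha> * (1 / g t) + \<beta> * (1 / g t)\<^sup>2) (at t within S)"
proof -
  have "(g has_real_derivative (w + \<beta> / \<alpha>) * (exp (- \<alpha> * t) * - \<alpha>)) (at t within S)"
    unfolding g by (auto intro!: derivative_eq_intros)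
  also have "(w + \<beta> / \<alpha>) * (exp (- \<alpha> * t) * - \<alpha>) = - \<alpha> * g t - \<beta>"
    using \<open>\<alpha> \<noteq> 0\<close> by (simp add: g field_simps)
  finally have "(g has_real_derivative - \<alpha> * g t - \<beta>) (at t within S)" .
  then show ?thesis
    using \<open>g t \<noteq> 0\<close>
    by (auto intro!: derivative_eq_intros simp: field_simps power2_eq_square)
qed

lemma ratio_of_solutions_limit:
  fixes \<alpha> k v w :: real
  assumes "\<alpha> < 0" and "w + k \<noteq> 0"
    and r: "\<And>t. 0 \<le> t \<Longrightarrow> 1 / r t = (w + k) * exp (- \<alpha> * t) - k"
    and s: "\<And>t. 0 \<le> t \<Longrightarrow> 1 / s t = (v + k) * exp (- \<alpha> * t) - k"
  shows "((\<lambda>t. r t / s t) \<longlongrightarrow> (v + k) / (w + k)) at_top"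
proof -
  have "filterlim (\<lambda>t. \<alpha> * t) at_bot at_top"
    using \<open>\<alpha> < 0\<close> filterlim_tendsto_neg_mult_at_bot[OF tendsto_const _ filterlim_ident] by blast
  then have "((\<lambda>t. exp (\<alpha> * t)) \<longlongrightarrow> 0) at_top"
    using exp_at_bot filterlim_compose by blast
  then have "((\<lambda>t. ((v + k) - k * exp (\<alpha> * t)) / ((w + k) - k * exp (\<alpha> * t)))
      \<longlongrightarrow> ((v + k) - k * 0) / ((w + k) - k * 0)) at_top"
    using \<open>w + k \<noteq> 0\<close> by (intro tendsto_intros) auto
  \<comment> \<open>Dividing both reciprocals by \<open>exp (- \<alpha> t)\<close> leaves only terms with a limit.\<close>
  moreover have "((v + k) - k * exp (\<alpha> * t)) / ((w + k) - k * exp (\<alpha> * t)) = r t / s t"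
    if "0 \<le> t" for t
  proof -
    have cancel: "z - k * exp (\<alpha> * t) = exp (\<alpha> * t) * (z * exp (- \<alpha> * t) - k)" for z
      by (simp add: exp_minus algebra_simps)
    show ?thesis
      unfolding cancel r[OF that, symmetric] s[OF that, symmetric] by simp
  qed
  then have "\<forall>\<^sub>F t in at_top.
      ((v + k) - k * exp (\<alpha> * t)) / ((w + k) - k * exp (\<alpha> * t)) = r t / s t"
    using eventually_ge_at_top[of 0] by (rule eventually_mono[rotated])
  ultimately show ?thesis
    using Lim_transform_eventually by fastforce
qed

section \<open>The flow starting from an ellipsoid\<close>

text \<open>The norm whose unit ball is the ellipsoid with reciprocal semi-axes \<open>q\<close>. Reciprocals are
  the quantities in which the flow is linear.\<close>

definition ellipsoid_norm :: "real ^ 3 \<Rightarrow> real ^ 3 \<Rightarrow> real" where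
  "ellipsoid_norm q x = norm (\<chi> i. q $ i * x $ i)"

lemma ellipsoid_norm_axis:
  assumes "0 < q $ i"
  shows "ellipsoid_norm q (axis i 1) = q $ i"
proof -
  have "(\<chi> j. q $ j * axis i 1 $ j) = q $ i *\<^sub>R axis i 1"
    by (simp add: vec_eq_iff axis_def)
  then show ?thesis
    using assms by (simp add: ellipsoid_norm_def)
qed

lemma coordinate_ellipsoid_unit_ball:
  assumes "\<And>i. 0 < q $ i"
  shows "coordinate_ellipsoid {x. ellipsoid_norm q x \<le> 1}"
  unfolding coordinate_ellipsoid_def
proof (intro exI conjI allI)
  show "0 < (\<chi> i. 1 / q $ i) $ i" for i
    using assms by simp
  show "{x. ellipsoid_norm q x \<le> 1} =
      {x. (\<Sum>i\<in>UNIV. (x $ i / (\<chi> i. 1 / q $ i) $ i)\<^sup>2) \<le> 1}"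
    by (simp add: ellipsoid_norm_def norm_vec_def L2_set_def mult.commute)
qed

text \<open>The body at time \<open>t\<close> has \<open>a = exp (- \<alpha> t)\<close> and \<open>b = k (exp (- \<alpha> t) - 1)\<close>.\<close>

lemma positive_gauge_combination:
  assumes "\<And>i. 0 < q $ i" and "0 < a" and "0 \<le> b"
  shows "positive_gauge (\<lambda>x. a * ellipsoid_norm q x + b * norm x)"
proof
  show "continuous_on UNIV (\<lambda>x. a * ellipsoid_norm q x + b * norm x)"
    unfolding ellipsoid_norm_def by (intro continuous_intros)
next
  fix x :: "real ^ 3"
  assume "x \<noteq> 0"
  then have "(\<chi> i. q $ i * x $ i) \<noteq> 0"
    using assms(1) by (simp add: vec_eq_iff less_imp_neq[symmetric])
  then have "0 < ellipsoid_norm q x"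
    by (simp add: ellipsoid_norm_def)
  then show "0 < a * ellipsoid_norm q x + b * norm x"
    using assms by (simp add: add_pos_nonneg)
next
  fix c :: real and x :: "real ^ 3"
  assume "0 \<le> c"
  have "(\<chi> i. q $ i * (c *\<^sub>R x) $ i) = c *\<^sub>R (\<chi> i. q $ i * x $ i)"
    by (simp add: vec_eq_iff)
  with \<open>0 \<le> c\<close> show "a * ellipsoid_norm q (c *\<^sub>R x) + b * norm (c *\<^sub>R x)
      = c * (a * ellipsoid_norm q x + b * norm x)"
    by (simp add: ellipsoid_norm_def algebra_simps)
qed

lemma positive_gauge_ellipsoid_norm:
  assumes "\<And>i. 0 < q $ i"
  shows "positive_gauge (ellipsoid_norm q)"
  using positive_gauge_combination[OF assms, of 1 0] by simp

lemma radial_flow_exists: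
  fixes \<alpha> \<beta> :: real
  assumes "\<alpha> < 0" and "\<beta> < 0" and q: "\<And>i. 0 < q $ i"
  shows "\<exists>E r. radial_flow (\<lambda>x. \<alpha> * x + \<beta> * x\<^sup>2) {x. ellipsoid_norm q x \<le> 1} E r"
proof -
  let ?N = "ellipsoid_norm q" and ?k = "\<beta> / \<alpha>"
  define G where "G t x = exp (- \<alpha> * t) * ?N x + ?k * (exp (- \<alpha> * t) - 1) * norm x" for t x
  have "0 < ?k"
    using assms by (simp add: zero_less_divide_iff)
  have gauge: "positive_gauge (G t)" if "0 \<le> t" for t
  proof -
    have "1 \<le> exp (- \<alpha> * t)"
      using \<open>\<alpha> < 0\<close> that by (simp add: mult_nonpos_nonneg)
    then show ?thesis
      unfolding G_def[abs_def] using \<open>0 < ?k\<close>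
      by (intro positive_gauge_combination q mult_nonneg_nonneg) auto
  qed
  have G0: "G 0 = ?N"
    by (simp add: G_def fun_eq_iff)
  have "radial_flow (\<lambda>x. \<alpha> * x + \<beta> * x\<^sup>2) {x. ?N x \<le> 1} (\<lambda>t. {x. G t x \<le> 1}) (\<lambda>u t. 1 / G t u)"
    unfolding radial_flow_def
  proof (intro conjI ballI allI impI)
    show "{x. G 0 x \<le> 1} = {x. ?N x \<le> 1}"
      by (simp add: G0)
  next
    fix t :: real
    assume "0 \<le> t"
    then interpret positive_gauge "G t"
      by (rule gauge)
    show "compact {x. G t x \<le> 1}" "0 \<in> interior {x. G t x \<le> 1}"
      "frontier {x. G t x \<le> 1} = {(1 / G t u) *\<^sub>R u | u. u \<in> sphere 0 1}"
      by (rule compact_sublevel zero_in_interior_sublevel frontier_sublevel_radial)+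
  next
    fix u :: "real ^ 3"
    assume "u \<in> sphere 0 1"
    then have "u \<noteq> 0" and unit: "norm u = 1"
      by auto
    then show "1 / G 0 u = radial_function {x. ?N x \<le> 1} u"
      using radial_function_sublevel[OF positive_gauge_ellipsoid_norm[OF q]]
      by (simp add: G0)
    fix t :: real
    assume "0 \<le> t"
    have "0 < G t u"
      using positive_gauge.positive[OF gauge[OF \<open>0 \<le> t\<close>] \<open>u \<noteq> 0\<close>] .
    then show "0 < 1 / G t u"
      by simp
    show "((\<lambda>t. 1 / G t u) has_real_derivative \<alpha> * (1 / G t u) + \<beta> * (1 / G t u)\<^sup>2)
        (at t within {0..})"
    proof (rule radial_solution_of_reciprocal)
      show "G s u = (?N u + ?k) * exp (- \<alpha> * s) - ?k" for s
        by (simp add: G_def unit algebra_simps)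
    qed (use \<open>\<alpha> < 0\<close> \<open>0 < G t u\<close> in auto)
  qed
  then show ?thesis
    by blast
qed

text \<open>The flow fixes the axis values: any flow from the ellipsoid, not only the one constructed
  above, satisfies the radial equation along each axis, and positive solutions of it are explicit.\<close>

lemma radial_flow_axis_value:
  assumes flow: "radial_flow (\<lambda>x. \<alpha> * x + \<beta> * x\<^sup>2) {x. ellipsoid_norm q x \<le> 1} E r"
    and "\<alpha> \<noteq> 0" and q: "\<And>i. 0 < q $ i" and "0 \<le> t"
  shows "0 < r (axis i 1) t"
    and "1 / r (axis i 1) t = (q $ i + \<beta> / \<alpha>) * exp (- \<alpha> * t) - \<beta> / \<alpha>"
proof -
  let ?u = "axis i 1 :: real ^ 3"
  have u: "?u \<in> sphere 0 1" "?u \<noteq> 0"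
    by simp_all
  have pos: "0 < r ?u s"
    and ode: "(r ?u has_real_derivative \<alpha> * r ?u s + \<beta> * (r ?u s)\<^sup>2) (at s within {0..})"
    if "0 \<le> s" for s
    using flow u(1) that unfolding radial_flow_def by blast+
  have "r ?u 0 = radial_function {x. ellipsoid_norm q x \<le> 1} ?u"
    using flow u(1) unfolding radial_flow_def by blast
  also have "\<dots> = 1 / q $ i"
    using radial_function_sublevel[OF positive_gauge_ellipsoid_norm[OF q] u(2)]
    by (simp add: ellipsoid_norm_axis q)
  finally have "1 / r ?u 0 = q $ i"
    by simp
  then show "1 / r ?u t = (q $ i + \<beta> / \<alpha>) * exp (- \<alpha> * t) - \<beta> / \<alpha>"
    using reciprocal_of_radial_solution[OF \<open>\<alpha> \<noteq> 0\<close> pos ode \<open>0 \<le> t\<close>] by simp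
  show "0 < r ?u t"
    using pos \<open>0 \<le> t\<close> .
qed

lemma axis_ratios_of_ordered:
  assumes "r (axis 1 1) t \<le> r (axis 2 1) t" and "r (axis 2 1) t \<le> r (axis 3 1) t"
  shows "axis_ratio1 r t = r (axis 1 1) t / r (axis 3 1) t"
    and "axis_ratio2 r t = r (axis 2 1) t / r (axis 3 1) t"
proof -
  have "axis_values r t = [r (axis 1 1) t, r (axis 2 1) t, r (axis 3 1) t]"
    using assms by (simp add: axis_values_def)
  then show "axis_ratio1 r t = r (axis 1 1) t / r (axis 3 1) t"
    and "axis_ratio2 r t = r (axis 2 1) t / r (axis 3 1) t"
    by (simp_all add: axis_ratio1_def axis_ratio2_def)
qed

theorem proposition1:
  fixes \<alpha> \<beta> y1 y2 :: real and f :: "real \<Rightarrow> real"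
  assumes "\<alpha> < 0" and "\<beta> < 0"
    and "0 < y1" and "y1 \<le> y2" and "y2 \<le> 1"
    and "\<And>x. f x = \<alpha> * x + \<beta> * x\<^sup>2"
  shows "\<exists>E0. coordinate_ellipsoid E0 \<and>
    (\<exists>E r. radial_flow f E0 E r) \<and>
    (\<forall>E r. radial_flow f E0 E r \<longrightarrow>
       (\<forall>t\<ge>0. 0 < axis_ratio1 r t \<and> axis_ratio1 r t \<le> axis_ratio2 r t \<and> axis_ratio2 r t \<le> 1) \<and>
       (axis_ratio1 r \<longlongrightarrow> y1) at_top \<and>
       (axis_ratio2 r \<longlongrightarrow> y2) at_top)"
proof -
  have f: "f = (\<lambda>x. \<alpha> * x + \<beta> * x\<^sup>2)"
    using assms(6) by (simp add: fun_eq_iff)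
  define k where "k = \<beta> / \<alpha>"
  have "0 < k"
    using assms by (simp add: k_def zero_less_divide_iff)
  have "0 < y2"
    using assms by simp
  \<comment> \<open>The longest axis is the third one, normalised to \<open>1\<close>; the other two entries solve
    \<open>(1 + k) / (q + k) = y\<close>.\<close>
  define q :: "real ^ 3" where "q = vector [(1 + k) / y1 - k, (1 + k) / y2 - k, 1]"
  have q1: "q $ 1 + k = (1 + k) / y1" and q2: "q $ 2 + k = (1 + k) / y2" and q3: "q $ 3 = 1"
    by (simp_all add: q_def)
  have "(1 + k) / 1 \<le> (1 + k) / y2" "(1 + k) / y2 \<le> (1 + k) / y1"
    using assms \<open>0 < k\<close> \<open>0 < y2\<close> by (intro divide_left_mono; simp)+
  then have order: "q $ 3 \<le> q $ 2" "q $ 2 \<le> q $ 1"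
    unfolding q1[symmetric] q2[symmetric] using q3 by simp_all
  then have "0 < q $ 1" "0 < q $ 2" "0 < q $ 3"
    using q3 by simp_all
  then have q: "0 < q $ i" for i
    using exhaust_3[of i] by auto
  have "(\<forall>t\<ge>0. 0 < axis_ratio1 r t \<and> axis_ratio1 r t \<le> axis_ratio2 r t \<and> axis_ratio2 r t \<le> 1) \<and>
       (axis_ratio1 r \<longlongrightarrow> y1) at_top \<and> (axis_ratio2 r \<longlongrightarrow> y2) at_top"
    if flow: "radial_flow f {x. ellipsoid_norm q x \<le> 1} E r" for E r
  proof -
    let ?r = "\<lambda>i. r (axis i 1)"
    have pos: "0 < ?r i t" and reciprocal: "1 / ?r i t = (q $ i + k) * exp (- \<alpha> * t) - k"
      if "0 \<le> t" for i t
      using radial_flow_axis_value[OF flow[unfolded f] _ q that] \<open>\<alpha> < 0\<close>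
      by (simp_all add: k_def)
    have mono: "?r i t \<le> ?r j t" if "0 \<le> t" "q $ j \<le> q $ i" for i j t
    proof -
      have "1 / ?r j t \<le> 1 / ?r i t"
        unfolding reciprocal[OF that(1)] using that(2) by (simp add: mult_right_mono)
      then show ?thesis
        using pos[OF that(1)] by (simp add: field_simps)
    qed
    have ratio1: "axis_ratio1 r t = ?r 1 t / ?r 3 t" and ratio2: "axis_ratio2 r t = ?r 2 t / ?r 3 t"
      if "0 \<le> t" for t
      using axis_ratios_of_ordered[of r t] mono[OF that] order by blast+
    have bounds: "0 < axis_ratio1 r t \<and> axis_ratio1 r t \<le> axis_ratio2 r t \<and> axis_ratio2 r t \<le> 1"
      if "0 \<le> t" for t
      using pos[OF that] mono[OF that] order
      by (simp add: ratio1 ratio2 that divide_right_mono less_imp_le)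
    have limit: "((\<lambda>t. ?r i t / ?r 3 t) \<longlongrightarrow> (1 + k) / (q $ i + k)) at_top" for i
      using ratio_of_solutions_limit[OF \<open>\<alpha> < 0\<close> _ reciprocal reciprocal, of i 3] q[of i] \<open>0 < k\<close> q3
      by simp
    have "((\<lambda>t. ?r 1 t / ?r 3 t) \<longlongrightarrow> y1) at_top" "((\<lambda>t. ?r 2 t / ?r 3 t) \<longlongrightarrow> y2) at_top"
      using limit[of 1] limit[of 2] \<open>0 < k\<close> by (simp_all add: q1 q2)
    moreover have "\<forall>\<^sub>F t in at_top. ?r 1 t / ?r 3 t = axis_ratio1 r t"
      "\<forall>\<^sub>F t in at_top. ?r 2 t / ?r 3 t = axis_ratio2 r t"
      using eventually_ge_at_top[of 0] by (rule eventually_mono; simp add: ratio1 ratio2)+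
    ultimately show ?thesis
      using bounds Lim_transform_eventually by blast
  qed
  moreover have "\<exists>E r. radial_flow f {x. ellipsoid_norm q x \<le> 1} E r"
    unfolding f using assms(1,2) q by (rule radial_flow_exists)
  ultimately show ?thesis
    using coordinate_ellipsoid_unit_ball[OF q] by blast
qed

end
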